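(* Let the basis functions of the random polynomials $\Phi_n$ be orthonormal polynomials on the unit circle $\{\varphi_j\}_{j=0}^\infty$ belonging to the Nevai class, and let $v\in\mathbb{C}$. Then, as $n\to\infty$, locally uniformly for $z\in\mathbb{D}$, $$\rho_{n,v}(z)=\frac1\pi\left(\frac{1}{(1-|z|^2)^2}+\frac{|v|^2[1-|z|^2+o(1)]}{|\varphi_{n+1}^{*}(z)|^2}\left|\frac{z}{1-|z|^2}+\frac{\overline{\varphi_{n+1}^{*\,\prime}(z)}+o(1)}{\overline{\varphi_{n+1}^{*}(z)}}\right|^2\right)\exp\left(-\frac{|v|^2(1-|z|^2)}{|\varphi_{n+1}^{*}(z)|^2}+o(1)\right),$$ where each $o(1)$ denotes a quantity depending on $n$ and $z$ that tends to $0$ as $n\to\infty$, locally uniformly for $z\in\mathbb{D}$.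
   Context: $\mathbb{D}$ is the open unit disk and $\mathbb{T}$ the unit circle. $\{\varphi_j\}_{j=0}^\infty$ are the orthonormal polynomials on the unit circle (OPUC) with respect to a probability Borel measure $\mu$ on $\mathbb{T}$ (with infinite support): $\deg\varphi_j=j$, positive leading coefficient, and $\int_{\mathbb{T}}\varphi_j(e^{i\theta})\overline{\varphi_k(e^{i\theta})}\,d\mu(e^{i\theta})=\delta_{jk}$; in particular $\varphi_0=1$. The reversed polynomial is $\varphi_n^{*}(z)=z^n\overline{\varphi_n(1/\overline z)}$, all of whose zeros lie outside $\mathbb{D}$, and $\varphi_n^{*\,\prime}$ is its derivative. The sequence belongs to the Nevai class if $\lim_{n\to\infty}\varphi_n(z)/\varphi_n^{*}(z)=0$ locally uniformly for $z\in\mathbb{D}$. The random polynomial is $\Phi_n(z)=\sum_{j=0}^n\eta_j\varphi_j(z)$ with $\eta_j$ i.i.d. standard complex normal. With $K_n(z,w)=\sum_{j=0}^n\varphi_j(z)\overline{\varphi_j(w)}$ and $K_n^{(k,l)}(z,w)=\sum_{j=0}^n\varphi_j^{(k)}(z)\overline{\varphi_j^{(l)}(w)}$ (superscripts $(k),(l)$ denoting derivatives), the density $\rho_{n,v}$ of the expected number of roots of $\Phi_n(z)=v$ is the function $$\rho_{n,v}(z)=\frac1\pi\left[\frac{K_n^{(1,1)}(z,z)}{K_n(z,z)}-\frac{|K_n^{(0,1)}(z,z)|^2}{K_n(z,z)^2}\left(1-\frac{|v|^2}{K_n(z,z)}\right)\right]\exp\left(-\frac{|v|^2}{K_n(z,z)}\right).$$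 *)

theory Defs
  imports "HOL-Probability.Probability" "HOL-Computational_Algebra.Polynomial"
begin

definition circle_prob_measure :: "complex measure \<Rightarrow> bool" where
  "circle_prob_measure \<mu> \<longleftrightarrow>
     prob_space \<mu> \<and> sets \<mu> = sets (restrict_space borel (sphere (0::complex) 1))"

definition circle_support :: "complex measure \<Rightarrow> complex set" where
  "circle_support \<mu> =
     {z \<in> sphere 0 1. \<forall>U. open U \<longrightarrow> z \<in> U \<longrightarrow> emeasure \<mu> (U \<inter> sphere 0 1) > 0}"

definition opuc :: "complex measure \<Rightarrow> (nat \<Rightarrow> complex poly) \<Rightarrow> bool" where
  "opuc \<mu> \<phi> \<longleftrightarrow>
     circle_prob_measure \<mu> \<and> infinite (circle_support \<mu>) \<and>
     (\<forall>j. degree (\<phi> j) = j \<and> lead_coeff (\<phi> j) \<in> \<real> \<and> Re (lead_coeff (\<phi> j)) > 0) \<and>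
     (\<forall>j k. (\<integral>z. poly (\<phi> j) z * cnj (poly (\<phi> k) z) \<partial>\<mu>) = (if j = k then 1 else 0))"

text \<open>The reversed polynomial of \<open>p\<close>, of degree \<open>n\<close>, is the polynomial extension to \<open>z = 0\<close> of
  \<open>z ^ n * cnj (p (1 / cnj z))\<close>.\<close>

definition reversed_poly :: "complex poly \<Rightarrow> complex poly" where
  "reversed_poly p = reflect_poly (map_poly cnj p)"

lemma poly_reversed_poly:
  assumes "z \<noteq> 0"
  shows "poly (reversed_poly p) z = z ^ degree p * cnj (poly p (1 / cnj z))"
proof -
  have "degree (map_poly cnj p) = degree p"
    by (rule degree_map_poly) simp
  moreover have "inverse z = cnj (1 / cnj z)"
    by (simp add: divide_inverse)
  ultimately show ?thesis
    by (simp only: reversed_poly_def poly_reflect_poly_nz[OF assms] poly_cnj complex_cnj_cnj)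
qed

definition locally_uniform_limit ::
    "complex set \<Rightarrow> (nat \<Rightarrow> complex \<Rightarrow> 'a::metric_space) \<Rightarrow> (complex \<Rightarrow> 'a) \<Rightarrow> bool" where
  "locally_uniform_limit S f g \<longleftrightarrow>
     (\<forall>K. compact K \<longrightarrow> K \<subseteq> S \<longrightarrow> uniform_limit K f g sequentially)"

definition nevai_class :: "(nat \<Rightarrow> complex poly) \<Rightarrow> bool" where
  "nevai_class \<phi> \<longleftrightarrow>
     locally_uniform_limit (ball 0 1)
       (\<lambda>n z. poly (\<phi> n) z / poly (reversed_poly (\<phi> n)) z) (\<lambda>_. 0)"

text \<open>\<open>kernel_deriv \<phi> k l n z w\<close> is \<open>K_n\<close> with \<open>k\<close> derivatives in \<open>z\<close> and \<open>l\<close> derivatives in the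
  conjugate of \<open>w\<close>; \<open>K_n\<close> itself is the case \<open>k = l = 0\<close>.\<close>

definition kernel_deriv ::
    "(nat \<Rightarrow> complex poly) \<Rightarrow> nat \<Rightarrow> nat \<Rightarrow> nat \<Rightarrow> complex \<Rightarrow> complex \<Rightarrow> complex" where
  "kernel_deriv \<phi> k l n z w =
     (\<Sum>j\<le>n. poly ((pderiv ^^ k) (\<phi> j)) z * cnj (poly ((pderiv ^^ l) (\<phi> j)) w))"

lemma kernel_deriv_diag_real: "of_real (Re (kernel_deriv \<phi> k k n z z)) = kernel_deriv \<phi> k k n z z"
proof -
  have "kernel_deriv \<phi> k k n z z \<in> \<real>"
    unfolding kernel_deriv_def complex_norm_square[symmetric] by (intro sum_in_Reals Reals_of_real)
  then show ?thesis
    by (rule of_real_Re)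
qed

text \<open>The density of the expected number of solutions of \<open>(\<Sum>j\<le>n. \<eta> j * poly (\<phi> j) z) = v\<close>, where
  the \<open>\<eta> j\<close> are i.i.d. standard complex normal, taken as its explicit formula in terms of the kernels.
  The real parts lose nothing, by \<open>kernel_deriv_diag_real\<close>.\<close>

definition root_density :: "(nat \<Rightarrow> complex poly) \<Rightarrow> nat \<Rightarrow> complex \<Rightarrow> complex \<Rightarrow> real" where
  "root_density \<phi> n v z =
     (let K = Re (kernel_deriv \<phi> 0 0 n z z);
          K11 = Re (kernel_deriv \<phi> 1 1 n z z);
          K01 = kernel_deriv \<phi> 0 1 n z z
      in 1 / pi * (K11 / K - (cmod K01)\<^sup>2 / K\<^sup>2 * (1 - (cmod v)\<^sup>2 / K)) * exp (- ((cmod v)\<^sup>2 / K)))"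

end

theory Submission
  imports Defs "HOL-Complex_Analysis.Complex_Analysis"
begin

text \<open>
Write \<open>s\<close> and \<open>p\<close> for \<open>\<phi>\<^sub>n\<^sub>+\<^sub>1\<^sup>*\<close> and \<open>\<phi>\<^sub>n\<^sub>+\<^sub>1\<close>, \<open>b = p / s\<close>, and \<open>t = 1 - |z|\<^sup>2\<close>. The
Christoffel--Darboux formula (\<open>christoffel_darboux\<close>) gives
\<open>K\<^sub>n(z, z) = |s|\<^sup>2 (1 - |b|\<^sup>2) / t\<close>. Hence \<open>|b| < 1\<close> in the disk and \<open>s\<close> has no zero there. With \<open>K\<close>, \<open>K01\<close>
and \<open>K11\<close> for the values at \<open>(z, z)\<close> of the kernel, of its derivative in the conjugate of the
second variable, and of its mixed derivative, the quotients of kernels in the density are derivatives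
of \<open>log K\<^sub>n\<close>, so they can be read off from this product:
\<open>K01 / K\<close> equals \<open>z/t + cnj (s'/s) - b cnj b' / (1 - |b|\<^sup>2)\<close>, and
\<open>K11 / K - |K01|\<^sup>2 / K\<^sup>2\<close> equals \<open>1/t\<^sup>2 - |b'|\<^sup>2 / (1 - |b|\<^sup>2)\<^sup>2\<close>. So the density is an exact
expression in \<open>s\<close>, \<open>s'\<close>, \<open>b\<close> and \<open>b'\<close> (\<open>root_density_schur\<close>), and the asserted main term is
what remains of it for \<open>b = b' = 0\<close>. The Nevai condition says precisely that \<open>b\<close> tends to \<open>0\<close>
locally uniformly, and Cauchy's estimate transfers this to \<open>b'\<close>.

The delicate point is that \<open>s\<close> and \<open>s'/s\<close> need not stay bounded as \<open>n\<close> grows. In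
\<open>X = z/t + cnj (s'/s)\<close> an error \<open>c = o(1)\<close> may therefore change \<open>|X|\<^sup>2\<close> by an amount that is not
small, but the effect is small relative to the main bracket
\<open>D = 1/t\<^sup>2 + |v|\<^sup>2 (t/|s|\<^sup>2) |X|\<^sup>2\<close>: since \<open>D\<close> is at least \<open>1\<close> and
\<open>t/|s|\<^sup>2\<close> is at most \<open>1\<close>, replacing \<open>|X|\<^sup>2\<close> by \<open>|X - c|\<^sup>2\<close> costs at most
\<open>|c| (2 + |X|\<^sup>2)\<close> for \<open>|c|\<close> at most \<open>1\<close>, and every other error is similarly a small multiple of \<open>D\<close>
(\<open>log_bracket_perturbation\<close>). Thus the logarithm of the ratio of the true bracket to \<open>D\<close> tends to \<open>0\<close>
locally uniformly, and all errors can be collected in the exponent, with the first two error terms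
equal to zero. For the resulting identity to hold on the whole disk and not only on compact subsets,
the true bracket has to be positive everywhere; this is a strict Cauchy--Schwarz inequality
(\<open>kernel_cauchy_schwarz_strict\<close>).
\<close>

section \<open>The inner product on polynomials\<close>

definition circle_inner :: "complex measure \<Rightarrow> complex poly \<Rightarrow> complex poly \<Rightarrow> complex" where
  "circle_inner \<mu> f g = (\<integral>z. poly f z * cnj (poly g z) \<partial>\<mu>)"

lemma space_circle_prob_measure:
  assumes "circle_prob_measure \<mu>"
  shows "space \<mu> = sphere 0 1"
proof -
  have "space \<mu> = space (restrict_space borel (sphere (0::complex) 1))"
    using assms unfolding circle_prob_measure_def by (intro sets_eq_imp_space_eq) simp
  then show ?thesis
    by (simp add: space_restrict_space)
qed

lemma integrable_circle:
  fixes f :: "complex \<Rightarrow> complex"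
  assumes \<mu>: "circle_prob_measure \<mu>" and f: "continuous_on (sphere 0 1) f"
  shows "integrable \<mu> f"
proof -
  interpret prob_space \<mu>
    using \<mu> unfolding circle_prob_measure_def by simp
  have meas: "f \<in> borel_measurable \<mu>"
    using borel_measurable_continuous_on_restrict[OF f] \<mu>
    by (metis circle_prob_measure_def measurable_cong_sets)
  have "bounded (f ` sphere 0 1)"
    by (intro compact_imp_bounded compact_continuous_image f compact_sphere)
  then obtain B where "\<And>z. z \<in> sphere 0 1 \<Longrightarrow> norm (f z) \<le> B"
    unfolding bounded_iff by blast
  then show ?thesis
    by (intro integrable_const_bound[of _ B] meas AE_I2) (simp add: space_circle_prob_measure[OF \<mu>])
qed

lemma circle_inner_sum_left:
  assumes "circle_prob_measure \<mu>"
  shows "circle_inner \<mu> (\<Sum>j\<in>J. smult (c j) (e j)) g = (\<Sum>j\<in>J. c j * circle_inner \<mu> (e j) g)"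
proof -
  have "circle_inner \<mu> (\<Sum>j\<in>J. smult (c j) (e j)) g
      = (\<integral>z. (\<Sum>j\<in>J. c j * (poly (e j) z * cnj (poly g z))) \<partial>\<mu>)"
    unfolding circle_inner_def by (simp add: poly_sum sum_distrib_right mult.assoc)
  also have "\<dots> = (\<Sum>j\<in>J. \<integral>z. c j * (poly (e j) z * cnj (poly g z)) \<partial>\<mu>)"
    by (intro Bochner_Integration.integral_sum integrable_circle[OF assms] continuous_intros)
  finally show ?thesis
    by (simp add: circle_inner_def)
qed

lemma circle_inner_commute: "circle_inner \<mu> g f = cnj (circle_inner \<mu> f g)"
  unfolding circle_inner_def Bochner_Integration.integral_cnj[symmetric] by (simp add: mult.commute)

lemma circle_inner_cong:
  assumes "circle_prob_measure \<mu>"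
    and "\<And>z. cmod z = 1 \<Longrightarrow> poly f z * cnj (poly g z) = poly f' z * cnj (poly g' z)"
  shows "circle_inner \<mu> f g = circle_inner \<mu> f' g'"
  unfolding circle_inner_def
  by (rule Bochner_Integration.integral_cong) (auto simp: space_circle_prob_measure assms)

lemma circle_inner_shift:
  assumes "circle_prob_measure \<mu>"
  shows "circle_inner \<mu> (pCons 0 f) (pCons 0 g) = circle_inner \<mu> f g"
proof (rule circle_inner_cong[OF assms])
  fix z :: complex assume "cmod z = 1"
  then have "z * cnj z = 1"
    by (simp add: complex_norm_square[symmetric])
  moreover have "poly (pCons 0 f) z * cnj (poly (pCons 0 g) z)
      = (z * cnj z) * (poly f z * cnj (poly g z))"
    by (simp add: mult_ac)
  ultimately show "poly (pCons 0 f) z * cnj (poly (pCons 0 g) z) = poly f z * cnj (poly g z)"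
    by simp
qed

section \<open>Basis independence of the reproducing kernel\<close>

definition circle_orthonormal :: "complex measure \<Rightarrow> 'i set \<Rightarrow> ('i \<Rightarrow> complex poly) \<Rightarrow> bool" where
  "circle_orthonormal \<mu> J e \<longleftrightarrow>
     (\<forall>i\<in>J. \<forall>j\<in>J. circle_inner \<mu> (e i) (e j) = (if i = j then 1 else 0))"

lemma orthonormal_expansion:
  assumes \<mu>: "circle_prob_measure \<mu>" and "finite J" and e: "circle_orthonormal \<mu> J e"
    and g: "g = (\<Sum>j\<in>J. smult (c j) (e j))"
  shows "g = (\<Sum>j\<in>J. smult (circle_inner \<mu> g (e j)) (e j))"
proof -
  have "circle_inner \<mu> g (e k) = c k" if "k \<in> J" for k
  proof -
    have "circle_inner \<mu> g (e k) = (\<Sum>j\<in>J. if j = k then c j else 0)"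
      unfolding g circle_inner_sum_left[OF \<mu>] using e that
      by (intro sum.cong) (auto simp: circle_orthonormal_def)
    also have "\<dots> = c k"
      using \<open>finite J\<close> that by simp
    finally show ?thesis .
  qed
  then have "(\<Sum>j\<in>J. smult (circle_inner \<mu> g (e j)) (e j)) = (\<Sum>j\<in>J. smult (c j) (e j))"
    by (intro sum.cong) simp_all
  then show ?thesis
    using g by simp
qed

text \<open>This is what makes the Christoffel--Darboux formula easy: the sum below is the reproducing kernel
  of the common span, so evaluating it in two bases yields an identity between them.
  Expanding each \<open>e i\<close> in the \<open>f j\<close> and regrouping produces the expansions of the \<open>f j\<close> in the
  \<open>e i\<close>, because the two coefficient matrices are adjoint to each other.\<close>

lemma kernel_basis_independent:
  assumes \<mu>: "circle_prob_measure \<mu>" and fin: "finite I" "finite J"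
    and e: "circle_orthonormal \<mu> I e" and f: "circle_orthonormal \<mu> J f"
    and ef: "\<And>i. i \<in> I \<Longrightarrow> \<exists>c. e i = (\<Sum>j\<in>J. smult (c j) (f j))"
    and fe: "\<And>j. j \<in> J \<Longrightarrow> \<exists>c. f j = (\<Sum>i\<in>I. smult (c i) (e i))"
  shows "(\<Sum>i\<in>I. poly (e i) z * cnj (poly (e i) w)) = (\<Sum>j\<in>J. poly (f j) z * cnj (poly (f j) w))"
proof -
  have e_eq: "poly (e i) z = (\<Sum>j\<in>J. circle_inner \<mu> (e i) (f j) * poly (f j) z)" if "i \<in> I" for i
  proof -
    have "e i = (\<Sum>j\<in>J. smult (circle_inner \<mu> (e i) (f j)) (f j))"
      using ef[OF that] orthonormal_expansion[OF \<mu> fin(2) f] by blast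
    from arg_cong[OF this, of "\<lambda>p. poly p z"] show ?thesis
      by (simp add: poly_sum)
  qed
  have f_eq: "poly (f j) w = (\<Sum>i\<in>I. circle_inner \<mu> (f j) (e i) * poly (e i) w)" if "j \<in> J" for j
  proof -
    have "f j = (\<Sum>i\<in>I. smult (circle_inner \<mu> (f j) (e i)) (e i))"
      using fe[OF that] orthonormal_expansion[OF \<mu> fin(1) e] by blast
    from arg_cong[OF this, of "\<lambda>p. poly p w"] show ?thesis
      by (simp add: poly_sum)
  qed
  have "(\<Sum>i\<in>I. poly (e i) z * cnj (poly (e i) w))
      = (\<Sum>i\<in>I. \<Sum>j\<in>J. poly (f j) z * (circle_inner \<mu> (e i) (f j) * cnj (poly (e i) w)))"
    by (intro sum.cong refl) (simp add: e_eq sum_distrib_right sum_distrib_left mult_ac)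
  also have "\<dots> = (\<Sum>j\<in>J. poly (f j) z * (\<Sum>i\<in>I. circle_inner \<mu> (e i) (f j) * cnj (poly (e i) w)))"
    by (subst sum.swap) (simp add: sum_distrib_left)
  also have "\<dots> = (\<Sum>j\<in>J. poly (f j) z * cnj (poly (f j) w))"
    by (intro sum.cong refl)
      (simp add: f_eq circle_inner_commute[of \<mu> "e _" "f _", symmetric])
  finally show ?thesis .
qed

text \<open>Induction on the degree: subtracting a multiple of \<open>e n\<close> removes the leading term.\<close>

lemma graded_basis_spans:
  fixes e :: "nat \<Rightarrow> complex poly"
  assumes e: "\<And>j. degree (e j) = j" "\<And>j. e j \<noteq> 0" and "degree g \<le> n"
  shows "\<exists>c. g = (\<Sum>j\<le>n. smult (c j) (e j))"
  using \<open>degree g \<le> n\<close>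
proof (induction n arbitrary: g)
  case 0
  obtain a b where a: "g = [:a:]" and b: "e 0 = [:b:]" "b \<noteq> 0"
    using 0 e[of 0] by (metis degree_eq_zeroE le_zero_eq pCons_eq_0_iff)
  then show ?case
    by (intro exI[of _ "\<lambda>_. a / b"]) simp
next
  case (Suc n)
  define a where "a = coeff g (Suc n) / lead_coeff (e (Suc n))"
  have "coeff (e (Suc n)) (Suc n) \<noteq> 0"
    using e[of "Suc n"] by (metis leading_coeff_0_iff)
  then have top: "coeff (g - smult a (e (Suc n))) (Suc n) = 0"
    by (simp add: a_def e(1))
  have "degree (g - smult a (e (Suc n))) \<le> n"
  proof (intro degree_le allI impI)
    fix i assume "n < i"
    then consider "i = Suc n" | "i > Suc n"
      by linarith
    then show "coeff (g - smult a (e (Suc n))) i = 0"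
    proof cases
      case 2
      then show ?thesis
        using Suc.prems by (simp add: coeff_eq_0 e(1))
    qed (use top in simp)
  qed
  from Suc.IH[OF this] obtain c where c: "g - smult a (e (Suc n)) = (\<Sum>j\<le>n. smult (c j) (e j))" ..
  have "g = (\<Sum>j\<le>Suc n. smult ((c(Suc n := a)) j) (e j))"
    using c by (simp add: algebra_simps)
  then show ?case
    by (intro exI[of _ "c(Suc n := a)"])
qed

section \<open>The Christoffel--Darboux formula\<close>

lemma opuc_basics:
  assumes "opuc \<mu> \<phi>"
  shows "circle_prob_measure \<mu>" "degree (\<phi> j) = j" "\<phi> j \<noteq> 0"
    "circle_inner \<mu> (\<phi> j) (\<phi> k) = (if j = k then 1 else 0)"
  using assms unfolding opuc_def circle_inner_def by (auto dest!: spec[of _ j])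

lemma degree_reversed_poly_le: "degree (reversed_poly p) \<le> degree p"
  unfolding reversed_poly_def
  by (metis degree_map_poly degree_reflect_poly_le complex_cnj_zero_iff)

lemma poly_reversed_poly_circle:
  assumes "cmod z = 1"
  shows "poly (reversed_poly p) z = z ^ degree p * cnj (poly p z)"
proof -
  have "z * cnj z = 1"
    using assms by (simp add: complex_norm_square[symmetric])
  moreover from this have "z \<noteq> 0" "cnj z \<noteq> 0"
    by auto
  ultimately have "1 / cnj z = z"
    by (simp add: field_simps)
  then show ?thesis
    using poly_reversed_poly[OF \<open>z \<noteq> 0\<close>, of p] by simp
qed

text \<open>On the circle \<open>\<phi>\<^sub>N\<^sup>* = z\<^sup>N cnj \<phi>\<^sub>N\<close>, so pairing \<open>\<phi>\<^sub>N\<^sup>*\<close> with \<open>z \<phi>\<^sub>j\<close> is, up to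
  conjugation, pairing \<open>\<phi>\<^sub>N\<close> with \<open>z\<^bsup>N-1\<^esup> cnj \<phi>\<^sub>j = z\<^bsup>N-1-j\<^esup> \<phi>\<^sub>j\<^sup>*\<close>, a polynomial of degree
  below \<open>N\<close>.\<close>

lemma reversed_orthogonal_shift:
  assumes op: "opuc \<mu> \<phi>" and "j < N"
  shows "circle_inner \<mu> (reversed_poly (\<phi> N)) (pCons 0 (\<phi> j)) = 0"
proof -
  note basics = opuc_basics[OF op]
  define h where "h = monom 1 (N - 1 - j) * reversed_poly (\<phi> j)"
  have "degree h \<le> (N - 1 - j) + j"
    unfolding h_def using degree_reversed_poly_le[of "\<phi> j"]
    by (intro order_trans[OF degree_mult_le] add_mono) (simp_all add: degree_monom_eq basics)
  then have "degree h \<le> N - 1"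
    using \<open>j < N\<close> by simp
  then obtain c where c: "h = (\<Sum>i\<le>N - 1. smult (c i) (\<phi> i))"
    using graded_basis_spans[of \<phi> h "N - 1"] basics by blast
  have "circle_inner \<mu> h (\<phi> N) = (\<Sum>i\<le>N - 1. c i * circle_inner \<mu> (\<phi> i) (\<phi> N))"
    unfolding c by (rule circle_inner_sum_left[OF basics(1)])
  also have "\<dots> = 0"
    using \<open>j < N\<close> by (intro sum.neutral) (auto simp: basics)
  finally have "circle_inner \<mu> h (\<phi> N) = 0" .
  moreover have "circle_inner \<mu> (reversed_poly (\<phi> N)) (pCons 0 (\<phi> j)) = circle_inner \<mu> h (\<phi> N)"
  proof (rule circle_inner_cong[OF basics(1)])
    fix z :: complex assume z: "cmod z = 1"
    then have zz: "z * cnj z = 1"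
      by (simp add: complex_norm_square[symmetric])
    have "z ^ N * cnj z = z ^ (N - 1) * (z * cnj z)"
      using \<open>j < N\<close> by (metis less_nat_zero_code mult.assoc mult.commute not_gr_zero power_minus_mult)
    also have "\<dots> = z ^ (N - 1 - j) * z ^ j"
      using \<open>j < N\<close> by (simp add: zz flip: power_add)
    finally have "z ^ N * cnj z = z ^ (N - 1 - j) * z ^ j" .
    then show "poly (reversed_poly (\<phi> N)) z * cnj (poly (pCons 0 (\<phi> j)) z)
        = poly h z * cnj (poly (\<phi> N) z)"
      by (simp add: h_def poly_reversed_poly_circle[OF z] basics poly_monom mult_ac)
  qed
  ultimately show ?thesis by simp
qed

lemma reversed_normalized:
  assumes op: "opuc \<mu> \<phi>"
  shows "circle_inner \<mu> (reversed_poly (\<phi> N)) (reversed_poly (\<phi> N)) = 1"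
proof -
  have "circle_inner \<mu> (reversed_poly (\<phi> N)) (reversed_poly (\<phi> N)) = circle_inner \<mu> (\<phi> N) (\<phi> N)"
  proof (rule circle_inner_cong[OF opuc_basics(1)[OF op]])
    fix z :: complex assume z: "cmod z = 1"
    then have "z * cnj z = 1"
      by (simp add: complex_norm_square[symmetric])
    then have "z ^ N * cnj (z ^ N) = 1"
      by (metis complex_cnj_power power_mult_distrib power_one)
    moreover have "poly (reversed_poly (\<phi> N)) z * cnj (poly (reversed_poly (\<phi> N)) z)
        = (z ^ N * cnj (z ^ N)) * (poly (\<phi> N) z * cnj (poly (\<phi> N) z))"
      using opuc_basics(2)[OF op, of N]
      by (simp add: poly_reversed_poly_circle[OF z] mult_ac)
    ultimately show "poly (reversed_poly (\<phi> N)) z * cnj (poly (reversed_poly (\<phi> N)) z)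
        = poly (\<phi> N) z * cnj (poly (\<phi> N) z)"
      by simp
  qed
  then show ?thesis
    by (simp add: opuc_basics[OF op])
qed

text \<open>The polynomial \<open>\<phi>\<^sub>N\<^sup>*\<close> does not vanish at \<open>0\<close>, its value there being the conjugate of the leading
  coefficient of \<open>\<phi>\<^sub>N\<close>. Subtracting a multiple of it from \<open>g\<close> leaves a multiple of \<open>z\<close>.\<close>

lemma reversed_shift_basis_spans:
  assumes op: "opuc \<mu> \<phi>" and g: "degree g \<le> Suc n"
  shows "\<exists>c. g = (\<Sum>j\<le>Suc n. smult (c j)
            (if j = Suc n then reversed_poly (\<phi> (Suc n)) else pCons 0 (\<phi> j)))"
proof -
  note basics = opuc_basics[OF op]
  define s where "s = reversed_poly (\<phi> (Suc n))"
  \<comment> \<open>Chosen so that \<open>g - smult a s\<close> vanishes at \<open>0\<close>.\<close>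
  define a where "a = coeff g 0 / coeff s 0"
  have "coeff s 0 \<noteq> 0"
    unfolding s_def reversed_poly_def
    by (simp add: basics map_poly_eq_0_iff)
  then have "coeff (g - smult a s) 0 = 0"
    by (simp add: a_def)
  then obtain h where h: "g - smult a s = pCons 0 h"
    by (metis coeff_pCons_0 pCons_cases)
  have "degree s \<le> Suc n"
    unfolding s_def using degree_reversed_poly_le[of "\<phi> (Suc n)"] by (simp add: basics)
  then have "degree (pCons 0 h) \<le> Suc n"
    unfolding h[symmetric] using g
    by (intro degree_diff_le) (auto intro: order_trans[OF degree_smult_le])
  then have "degree h \<le> n"
    by (cases "h = 0") auto
  then obtain c where c: "h = (\<Sum>j\<le>n. smult (c j) (\<phi> j))"
    using graded_basis_spans[of \<phi> h n] basics by blast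
  have "pCons 0 h = [:0, 1:] * h"
    by simp
  also have "\<dots> = (\<Sum>j\<le>n. smult (c j) (pCons 0 (\<phi> j)))"
    unfolding c sum_distrib_left by (intro sum.cong) auto
  finally have "g = smult a s + (\<Sum>j\<le>n. smult (c j) (pCons 0 (\<phi> j)))"
    using h by (simp add: algebra_simps)
  also have "\<dots> = (\<Sum>j\<le>Suc n. smult ((c(Suc n := a)) j) (if j = Suc n then s else pCons 0 (\<phi> j)))"
    by (simp add: add.commute)
  finally show ?thesis
    unfolding s_def by blast
qed

text \<open>Multiplication by \<open>z\<close> is isometric on the circle, so for \<open>N = n + 1\<close> the polynomials of degree at
  most \<open>N\<close> have two orthonormal bases: \<open>\<phi>\<^sub>0, \<dots>, \<phi>\<^sub>N\<close>, and \<open>z\<phi>\<^sub>0, \<dots>, z\<phi>\<^sub>n\<close> together with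
  \<open>\<phi>\<^sub>N\<^sup>*\<close>. Comparing the reproducing kernel in both gives
  \<open>K\<^sub>n(z, w) + \<phi>\<^sub>N(z) cnj \<phi>\<^sub>N(w) = z cnj w K\<^sub>n(z, w) + \<phi>\<^sub>N\<^sup>*(z) cnj \<phi>\<^sub>N\<^sup>*(w)\<close>.\<close>

theorem christoffel_darboux:
  assumes op: "opuc \<mu> \<phi>"
  shows "(1 - z * cnj w) * kernel_deriv \<phi> 0 0 n z w
    = poly (reversed_poly (\<phi> (n + 1))) z * cnj (poly (reversed_poly (\<phi> (n + 1))) w)
      - poly (\<phi> (n + 1)) z * cnj (poly (\<phi> (n + 1)) w)"
proof -
  note basics = opuc_basics[OF op]
  define s where "s = reversed_poly (\<phi> (Suc n))"
  define f where "f j = (if j = Suc n then s else pCons 0 (\<phi> j))" for j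
  have deg_f: "degree (f j) \<le> Suc n" if "j \<le> Suc n" for j
    using that degree_reversed_poly_le[of "\<phi> (Suc n)"]
    by (auto simp: f_def s_def basics intro: order_trans[OF degree_pCons_le])
  have e: "circle_orthonormal \<mu> {..Suc n} \<phi>"
    by (simp add: circle_orthonormal_def basics)
  have f: "circle_orthonormal \<mu> {..Suc n} f"
    using reversed_orthogonal_shift[OF op, of _ "Suc n"]
    by (auto simp: circle_orthonormal_def f_def s_def circle_inner_shift basics
          reversed_normalized[OF op] circle_inner_commute[of \<mu> "pCons 0 _" "reversed_poly _"])
  have "(\<Sum>j\<le>Suc n. poly (\<phi> j) z * cnj (poly (\<phi> j) w)) = (\<Sum>j\<le>Suc n. poly (f j) z * cnj (poly (f j) w))"
  proof (rule kernel_basis_independent[OF basics(1) _ _ e f])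
    show "\<exists>c. \<phi> i = (\<Sum>j\<le>Suc n. smult (c j) (f j))" if "i \<in> {..Suc n}" for i
      unfolding f_def s_def using that by (intro reversed_shift_basis_spans[OF op]) (simp add: basics)
    show "\<exists>c. f j = (\<Sum>i\<le>Suc n. smult (c i) (\<phi> i))" if "j \<in> {..Suc n}" for j
      using that by (intro graded_basis_spans basics deg_f) simp
  qed simp_all
  moreover have "(\<Sum>j\<le>n. poly (f j) z * cnj (poly (f j) w)) = z * cnj w * kernel_deriv \<phi> 0 0 n z w"
    unfolding kernel_deriv_def sum_distrib_left by (intro sum.cong) (auto simp: f_def mult_ac)
  ultimately show ?thesis
    by (simp add: kernel_deriv_def f_def s_def algebra_simps)
qed

lemma pderiv_poly_cong:
  fixes p q :: "complex poly"
  assumes "\<And>z. poly p z = poly q z"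
  shows "poly (pderiv p) z = poly (pderiv q) z"
proof -
  have "p = q"
    using assms by (intro poly_eq_poly_eq_iff[THEN iffD1] ext)
  then show ?thesis by simp
qed

text \<open>For fixed \<open>w\<close> the formula is an identity between polynomials in \<open>z\<close>, which may be differentiated
  formally.\<close>

lemma christoffel_darboux_deriv_left:
  fixes n :: nat
  assumes op: "opuc \<mu> \<phi>"
  defines "p \<equiv> \<phi> (n + 1)" and "s \<equiv> reversed_poly (\<phi> (n + 1))"
  shows "(1 - z * cnj w) * kernel_deriv \<phi> 1 0 n z w
    = poly (pderiv s) z * cnj (poly s w) - poly (pderiv p) z * cnj (poly p w)
      + cnj w * kernel_deriv \<phi> 0 0 n z w"
proof -
  define k where "k = (\<Sum>j\<le>n. smult (cnj (poly (\<phi> j) w)) (\<phi> j))"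
  have "poly ([:1, - cnj w:] * k) z
      = poly (smult (cnj (poly s w)) s - smult (cnj (poly p w)) p) z" for z
    using christoffel_darboux[OF op, of z w n]
    by (simp add: k_def poly_sum kernel_deriv_def p_def s_def algebra_simps)
  from pderiv_poly_cong[OF this, of z] show ?thesis
    by (simp add: k_def poly_sum kernel_deriv_def pderiv_mult higher_pderiv_sum[where n = 1, simplified] pderiv_smult pderiv_diff
        pderiv_add pderiv_minus pderiv_pCons algebra_simps)
qed

lemma christoffel_darboux_deriv_both:
  fixes n :: nat
  assumes op: "opuc \<mu> \<phi>"
  defines "p \<equiv> \<phi> (n + 1)" and "s \<equiv> reversed_poly (\<phi> (n + 1))"
  shows "(1 - z * cnj w) * kernel_deriv \<phi> 1 1 n z w
    = poly (pderiv s) z * cnj (poly (pderiv s) w) - poly (pderiv p) z * cnj (poly (pderiv p) w)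
      + kernel_deriv \<phi> 0 0 n z w + z * kernel_deriv \<phi> 1 0 n z w + cnj w * kernel_deriv \<phi> 0 1 n z w"
proof -
  define k where "k = (\<Sum>j\<le>n. smult (cnj (poly (\<phi> j) z)) (\<phi> j))"
  define k' where "k' = (\<Sum>j\<le>n. smult (cnj (poly (pderiv (\<phi> j)) z)) (\<phi> j))"
  \<comment> \<open>Conjugation turns the antiholomorphic variable \<open>w\<close> into a polynomial one.\<close>
  have "poly ([:1, - cnj z:] * k') w = poly (smult (cnj (poly (pderiv s) z)) s
      - smult (cnj (poly (pderiv p) z)) p + [:0, 1:] * k) w" for w
    using arg_cong[OF christoffel_darboux_deriv_left[OF op, of z w n], of cnj]
    by (simp add: k_def k'_def poly_sum kernel_deriv_def p_def s_def algebra_simps)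
  from arg_cong[OF pderiv_poly_cong[OF this, of w], of cnj] show ?thesis
    by (simp add: k_def k'_def poly_sum kernel_deriv_def pderiv_mult higher_pderiv_sum[where n = 1, simplified] pderiv_smult
        pderiv_diff pderiv_add pderiv_minus pderiv_pCons algebra_simps)
qed


section \<open>The density in terms of the Schur quotient\<close>

lemma kernel_diag_ge_1:
  assumes "opuc \<mu> \<phi>"
  shows "Re (kernel_deriv \<phi> 0 0 n z z) \<ge> 1"
proof -
  interpret prob_space \<mu>
    using opuc_basics(1)[OF assms] unfolding circle_prob_measure_def by simp
  obtain a where a: "\<phi> 0 = [:a:]"
    using opuc_basics(2)[OF assms, of 0] by (metis degree_eq_zeroE)
  have "a * cnj a = 1"
    using opuc_basics(4)[OF assms, of 0 0] by (simp add: circle_inner_def a prob_space)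
  then have "complex_of_real ((cmod (poly (\<phi> 0) z))\<^sup>2) = 1"
    by (simp add: a complex_norm_square del: of_real_power)
  then have "(cmod (poly (\<phi> 0) z))\<^sup>2 = 1"
    using of_real_eq_1_iff by blast
  moreover have "(cmod (poly (\<phi> 0) z))\<^sup>2 \<le> (\<Sum>j\<le>n. (cmod (poly (\<phi> j) z))\<^sup>2)"
    by (rule member_le_sum[of 0 "{..n}" "\<lambda>j. (cmod (poly (\<phi> j) z))\<^sup>2"]) simp_all
  moreover have "Re (kernel_deriv \<phi> 0 0 n z z) = (\<Sum>j\<le>n. (cmod (poly (\<phi> j) z))\<^sup>2)"
    by (simp add: kernel_deriv_def complex_mult_cnj cmod_power2)
  ultimately show ?thesis by simp
qed

text \<open>Equality in the Cauchy--Schwarz inequality would make the vector of derivatives \<open>\<phi>\<^sub>j'(z)\<close> a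
  multiple of the vector of values \<open>\<phi>\<^sub>j(z)\<close>. The entries with \<open>j = 0\<close> force the factor to vanish,
  and those with \<open>j = 1\<close> exclude that.\<close>

lemma kernel_cauchy_schwarz_strict:
  assumes op: "opuc \<mu> \<phi>" and "n \<ge> 1"
  shows "(cmod (kernel_deriv \<phi> 0 1 n z z))\<^sup>2
    < Re (kernel_deriv \<phi> 0 0 n z z) * Re (kernel_deriv \<phi> 1 1 n z z)"
proof -
  note basics = opuc_basics[OF op]
  define K where "K = Re (kernel_deriv \<phi> 0 0 n z z)"
  define K' where "K' = Re (kernel_deriv \<phi> 1 1 n z z)"
  define L where "L = kernel_deriv \<phi> 1 0 n z z"
  define u where "u j = poly (\<phi> j) z" for j
  define u' where "u' j = poly (pderiv (\<phi> j)) z" for j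
  have K: "complex_of_real K = (\<Sum>j\<le>n. u j * cnj (u j))"
    using kernel_deriv_diag_real[of \<phi> 0 n z] by (simp add: K_def kernel_deriv_def u_def)
  have K': "complex_of_real K' = (\<Sum>j\<le>n. u' j * cnj (u' j))"
    using kernel_deriv_diag_real[of \<phi> 1 n z] by (simp add: K'_def kernel_deriv_def u'_def)
  have L: "L = (\<Sum>j\<le>n. u' j * cnj (u j))"
    by (simp add: L_def kernel_deriv_def u_def u'_def)
  have cnj_L: "cnj L = (\<Sum>j\<le>n. u j * cnj (u' j))"
    by (simp add: L mult.commute)
  have "K > 0"
    using kernel_diag_ge_1[OF op, of n z] by (simp add: K_def)
  \<comment> \<open>The multiple of \<open>u\<close> nearest to \<open>u'\<close> in the Euclidean norm.\<close>
  define c where "c = L / K"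
  have "complex_of_real (\<Sum>j\<le>n. (cmod (u' j - c * u j))\<^sup>2)
      = (\<Sum>j\<le>n. u' j * cnj (u' j) - cnj c * (u' j * cnj (u j)) - c * (u j * cnj (u' j))
          + c * cnj c * (u j * cnj (u j)))"
    by (simp add: complex_norm_square algebra_simps del: of_real_power)
  also have "\<dots> = K' - cnj c * L - c * cnj L + c * cnj c * K"
    by (simp only: sum.distrib sum_subtractf sum_distrib_left[symmetric] flip: K K' L cnj_L)
  also have "\<dots> = K' - L * cnj L / K"
    using \<open>K > 0\<close> by (simp add: c_def field_simps)
  also have "\<dots> = complex_of_real (K' - (cmod L)\<^sup>2 / K)"
    by (simp add: complex_norm_square del: of_real_power)
  finally have gap: "(\<Sum>j\<le>n. (cmod (u' j - c * u j))\<^sup>2) = K' - (cmod L)\<^sup>2 / K"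
    using of_real_eq_iff by blast
  \<comment> \<open>At \<open>j = 0\<close> the derivative vanishes but the value does not; at \<open>j = 1\<close> the derivative is a
    nonzero constant.\<close>
  have "\<exists>j\<le>n. u' j - c * u j \<noteq> 0"
  proof (cases "c = 0")
    case True
    have "degree (pderiv (\<phi> 1)) = 0" "pderiv (\<phi> 1) \<noteq> 0"
      using basics(2)[of 1] by (simp_all add: degree_pderiv pderiv_eq_0_iff)
    then obtain a where "pderiv (\<phi> 1) = [:a:]" "a \<noteq> 0"
      by (metis degree_eq_zeroE pCons_0_0)
    then have "u' 1 \<noteq> 0"
      by (simp add: u'_def)
    then have "u' 1 - c * u 1 \<noteq> 0"
      using True by simp
    then show ?thesis
      using \<open>n \<ge> 1\<close> by blast
  next
    case False
    obtain a where a: "\<phi> 0 = [:a:]"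
      using basics(2)[of 0] by (metis degree_eq_zeroE)
    then have "a \<noteq> 0"
      using basics(3)[of 0] by auto
    then have "u' 0 - c * u 0 \<noteq> 0"
      using False by (simp add: u'_def u_def a pderiv_pCons)
    then show ?thesis
      by blast
  qed
  then obtain j where "j \<le> n" "u' j - c * u j \<noteq> 0"
    by blast
  then have "0 < (\<Sum>j\<le>n. (cmod (u' j - c * u j))\<^sup>2)"
    by (intro sum_pos2[of _ j]) auto
  then have "(cmod L)\<^sup>2 < K * K'"
    using \<open>K > 0\<close> by (simp add: gap field_simps)
  moreover have "cmod (kernel_deriv \<phi> 0 1 n z z) = cmod L"
    by (subst complex_mod_cnj[symmetric]) (simp add: L_def kernel_deriv_def mult.commute)
  ultimately show ?thesis
    by (simp add: K_def K'_def)
qed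

text \<open>The mixed second derivative of \<open>log K\<close> for the Christoffel--Darboux kernel, with denominators
  cleared so that it becomes a polynomial identity; \<open>p' s - p s'\<close> is the numerator of \<open>(p / s)'\<close>.\<close>

lemma kernel_wronskian_identity:
  fixes t z K K11 K10 p s p' s' :: complex
  assumes t: "t = 1 - z * cnj z"
    and real: "cnj K = K"
    and K: "t * K = s * cnj s - p * cnj p"
    and K10: "t * K10 = s' * cnj s - p' * cnj p + cnj z * K"
    and K11: "t * K11 = s' * cnj s' - p' * cnj p' + K + z * K10 + cnj z * cnj K10"
  shows "t\<^sup>2 * (K * K11 - K10 * cnj K10) = K\<^sup>2 - (p' * s - p * s') * cnj (p' * s - p * s')"
proof -
  have K01: "t * cnj K10 = cnj s' * s - cnj p' * p + z * K"
    using arg_cong[OF K10, of cnj] by (simp add: t real mult.commute)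
  define E where "E = s' * cnj s - p' * cnj p"
  define F where "F = cnj s' * s - cnj p' * p"
  have e10: "t * K10 = E + cnj z * K" and e01: "t * cnj K10 = F + z * K"
    using K10 K01 by (simp_all add: E_def F_def)
  have "t\<^sup>2 * (K * K11 - K10 * cnj K10) = K * (t * (t * K11)) - (t * K10) * (t * cnj K10)"
    by (simp add: power2_eq_square algebra_simps)
  also have "t * (t * K11) = t * (s' * cnj s' - p' * cnj p') + t * K + z * (t * K10) + cnj z * (t * cnj K10)"
    unfolding K11 by (simp add: algebra_simps)
  also have "K * (t * (s' * cnj s' - p' * cnj p') + t * K + z * (t * K10) + cnj z * (t * cnj K10))
        - (t * K10) * (t * cnj K10)
      = (t * K) * (s' * cnj s' - p' * cnj p') + K\<^sup>2 - E * F"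
    unfolding e10 e01 by (simp add: t power2_eq_square algebra_simps)
  also have "\<dots> = K\<^sup>2 - (p' * s - p * s') * cnj (p' * s - p * s')"
    unfolding K E_def F_def by (simp add: algebra_simps)
  finally show ?thesis .
qed

text \<open>Both estimates come from \<open>|\<phi>\<^sub>N\<^sup>*|\<^sup>2 - |\<phi>\<^sub>N|\<^sup>2 = (1 - |z|\<^sup>2) K\<^sub>n(z, z)\<close> and \<open>K\<^sub>n(z, z) \<ge> 1\<close>. The second
  bounds the factor \<open>(1 - |z|\<^sup>2) / |\<phi>\<^sub>N\<^sup>*|\<^sup>2\<close> of the density uniformly in the disk.\<close>

lemma reversed_dominates:
  assumes op: "opuc \<mu> \<phi>" and z: "cmod z < 1"
  shows "cmod (poly (\<phi> (n + 1)) z) < cmod (poly (reversed_poly (\<phi> (n + 1))) z)"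
    and "1 - (cmod z)\<^sup>2 \<le> (cmod (poly (reversed_poly (\<phi> (n + 1))) z))\<^sup>2"
proof -
  define K where "K = Re (kernel_deriv \<phi> 0 0 n z z)"
  have "complex_of_real ((1 - (cmod z)\<^sup>2) * K)
      = complex_of_real ((cmod (poly (reversed_poly (\<phi> (n + 1))) z))\<^sup>2 - (cmod (poly (\<phi> (n + 1)) z))\<^sup>2)"
    using christoffel_darboux[OF op, of z z n] kernel_deriv_diag_real[of \<phi> 0 n z]
    by (simp add: K_def complex_norm_square del: of_real_power)
  then have K: "(1 - (cmod z)\<^sup>2) * K
      = (cmod (poly (reversed_poly (\<phi> (n + 1))) z))\<^sup>2 - (cmod (poly (\<phi> (n + 1)) z))\<^sup>2"
    using of_real_eq_iff by blast
  have "0 < 1 - (cmod z)\<^sup>2"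
    using z by (simp add: abs_square_less_1)
  moreover have "1 \<le> K"
    unfolding K_def by (rule kernel_diag_ge_1[OF op])
  ultimately have "1 - (cmod z)\<^sup>2 \<le> (1 - (cmod z)\<^sup>2) * K" "0 < (1 - (cmod z)\<^sup>2) * K"
    using mult_left_mono[of 1 K "1 - (cmod z)\<^sup>2"] by simp_all
  then show "cmod (poly (\<phi> (n + 1)) z) < cmod (poly (reversed_poly (\<phi> (n + 1))) z)"
    and "1 - (cmod z)\<^sup>2 \<le> (cmod (poly (reversed_poly (\<phi> (n + 1))) z))\<^sup>2"
    unfolding K using zero_le_power2[of "cmod (poly (\<phi> (n + 1)) z)"]
    by (simp add: power2_less_imp_less, linarith)
qed

text \<open>For an orthonormal polynomial of positive degree this quotient maps the disk into itself; it is the finite Blaschke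
  product that the Nevai condition makes small.\<close>

definition schur_quotient :: "complex poly \<Rightarrow> complex \<Rightarrow> complex" where
  "schur_quotient p z = poly p z / poly (reversed_poly p) z"

lemma schur_quotient_has_derivative:
  assumes "poly (reversed_poly p) z \<noteq> 0"
  shows "(schur_quotient p has_field_derivative
    (poly (pderiv p) z * poly (reversed_poly p) z - poly p z * poly (pderiv (reversed_poly p)) z)
      / (poly (reversed_poly p) z)\<^sup>2) (at z)"
  unfolding schur_quotient_def [abs_def] power2_eq_square
  by (intro DERIV_divide poly_DERIV assms)

text \<open>The density without any approximation. The bracket is the sum of \<open>A\<close>, the part of it for
  \<open>v = 0\<close>, and of the nonnegative part carried by \<open>v\<close>, in which \<open>Y\<close> is \<open>K01 / K\<close> and \<open>q\<close>
  is \<open>|v|\<^sup>2 / K\<close>.\<close>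

lemma root_density_schur:
  fixes \<phi> v z and n :: nat
  defines "s \<equiv> poly (reversed_poly (\<phi> (n + 1))) z"
    and "s' \<equiv> poly (pderiv (reversed_poly (\<phi> (n + 1)))) z"
    and "b \<equiv> schur_quotient (\<phi> (n + 1)) z"
    and "b' \<equiv> deriv (schur_quotient (\<phi> (n + 1))) z"
    and "t \<equiv> 1 - (cmod z)\<^sup>2"
  defines "A \<equiv> 1 / t\<^sup>2 - ((cmod b') / (1 - (cmod b)\<^sup>2))\<^sup>2"
    and "Y \<equiv> z / of_real t + cnj s' / cnj s - b * cnj b' / of_real (1 - (cmod b)\<^sup>2)"
    and "q \<equiv> (cmod v)\<^sup>2 * (t / (cmod s)\<^sup>2) / (1 - (cmod b)\<^sup>2)"
  assumes op: "opuc \<mu> \<phi>" and z: "cmod z < 1" and n: "n \<ge> 1"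
  shows "root_density \<phi> n v z = 1 / pi * (A + q * (cmod Y)\<^sup>2) * exp (- q)" and "A > 0"
proof -
  define p where "p = poly (\<phi> (n + 1)) z"
  define p' where "p' = poly (pderiv (\<phi> (n + 1))) z"
  define K where "K = Re (kernel_deriv \<phi> 0 0 n z z)"
  define K11 where "K11 = Re (kernel_deriv \<phi> 1 1 n z z)"
  define L where "L = kernel_deriv \<phi> 1 0 n z z"
  define W where "W = p' * s - p * s'"
  have L_cnj: "kernel_deriv \<phi> 0 1 n z z = cnj L"
    by (simp add: L_def kernel_deriv_def mult.commute)
  have Kc: "kernel_deriv \<phi> 0 0 n z z = of_real K" "kernel_deriv \<phi> 1 1 n z z = of_real K11"
    unfolding K_def K11_def by (simp_all only: kernel_deriv_diag_real)
  have tc: "complex_of_real t = 1 - z * cnj z"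
    by (simp add: t_def complex_norm_square del: of_real_power)
  have t: "t > 0"
    using z by (simp add: t_def abs_square_less_1)
  have K: "K \<ge> 1"
    unfolding K_def by (rule kernel_diag_ge_1[OF op])
  have dom: "cmod p < cmod s"
    unfolding p_def s_def by (rule reversed_dominates(1)[OF op z])
  then have s: "s \<noteq> 0"
    by auto
  have b: "b = p / s"
    by (simp add: b_def p_def s_def schur_quotient_def)
  have b': "b' = W / s\<^sup>2"
    unfolding b'_def W_def p'_def p_def s'_def s_def
    using DERIV_imp_deriv[OF schur_quotient_has_derivative[of "\<phi> (n + 1)" z]] s
    by (simp add: s_def)
  have cdc: "complex_of_real t * of_real K = s * cnj s - p * cnj p"
    using christoffel_darboux[OF op, of z z n] by (simp add: tc Kc p_def s_def)
  also have "\<dots> = complex_of_real ((cmod s)\<^sup>2 - (cmod p)\<^sup>2)"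
    by (simp add: complex_norm_square del: of_real_power)
  finally have cd: "t * K = (cmod s)\<^sup>2 - (cmod p)\<^sup>2"
    by (metis of_real_eq_iff of_real_mult)
  have cd10: "complex_of_real t * L = s' * cnj s - p' * cnj p + cnj z * of_real K"
    using christoffel_darboux_deriv_left[OF op, of z z n]
    by (simp add: tc Kc L_def p_def s_def p'_def s'_def)
  have cd11: "complex_of_real t * of_real K11
      = s' * cnj s' - p' * cnj p' + of_real K + z * L + cnj z * cnj L"
    using christoffel_darboux_deriv_both[OF op, of z z n]
    by (simp only: tc Kc L_cnj p_def s_def p'_def s'_def L_def)
  have \<beta>: "1 - (cmod b)\<^sup>2 = t * K / (cmod s)\<^sup>2"
    unfolding cd b using s by (simp add: norm_divide power_divide field_simps)
  have "complex_of_real (t\<^sup>2 * (K * K11 - (cmod L)\<^sup>2)) = of_real (K\<^sup>2 - (cmod W)\<^sup>2)"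
    using kernel_wronskian_identity[OF tc _ cdc cd10 cd11]
    by (simp add: W_def complex_norm_square del: of_real_power complex_cnj_diff complex_cnj_mult)
      (simp add: power2_eq_square)
  then have wr: "t\<^sup>2 * (K * K11 - (cmod L)\<^sup>2) = K\<^sup>2 - (cmod W)\<^sup>2"
    using of_real_eq_iff by blast
  have "(cmod b') / (1 - (cmod b)\<^sup>2) = cmod W / (t * K)"
    using s t K by (simp add: \<beta> b' norm_divide norm_power)
  then have "A = (K\<^sup>2 - (cmod W)\<^sup>2) / (t\<^sup>2 * K\<^sup>2)"
    using t K by (simp add: A_def power_divide power_mult_distrib diff_divide_distrib)
  also have "\<dots> = (K * K11 - (cmod L)\<^sup>2) / K\<^sup>2"
    unfolding wr[symmetric] using t by simp
  finally have A: "A = (K * K11 - (cmod L)\<^sup>2) / K\<^sup>2" .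
  have "(cmod L)\<^sup>2 < K * K11"
    using kernel_cauchy_schwarz_strict[OF op n, of z] by (simp only: L_cnj complex_mod_cnj K_def K11_def)
  then show "A > 0"
    using K by (simp add: A)
  have q: "q = (cmod v)\<^sup>2 / K"
    using s t K by (simp add: q_def \<beta>)
  have "b * cnj b' / of_real (1 - (cmod b)\<^sup>2) = p * cnj W / (cnj s * of_real t * of_real K)"
    unfolding \<beta> unfolding b b' using s t K complex_norm_square[of s]
    by (simp add: field_simps power2_eq_square)
  then have Y: "Y = z / of_real t + cnj s' / cnj s - p * cnj W / (cnj s * of_real t * of_real K)"
    by (simp add: Y_def)
  have "Y * (cnj s * of_real t * of_real K)
      = z * of_real K * cnj s + cnj s' * (of_real t * of_real K) - p * cnj W"
    unfolding Y using s t K by (simp add: field_simps)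
  also have "\<dots> = cnj s * (z * of_real K + s * cnj s' - p * cnj p')"
    unfolding cdc W_def by (simp add: algebra_simps)
  also have "\<dots> = cnj s * cnj (of_real t * L)"
    unfolding cd10 by (simp add: algebra_simps)
  finally have "cnj L = Y * of_real K"
    using s t by simp
  then have "cmod L = cmod Y * K"
    using K by (metis abs_of_nonneg complex_mod_cnj norm_mult norm_of_real order_trans zero_le_one)
  then have "(cmod Y)\<^sup>2 = (cmod L)\<^sup>2 / K\<^sup>2"
    using K by (simp add: power_mult_distrib)
  then have "A + q * (cmod Y)\<^sup>2 = K11 / K - (cmod L)\<^sup>2 / K\<^sup>2 * (1 - (cmod v)\<^sup>2 / K)"
    using K by (simp add: A q field_simps power2_eq_square)
  then show "root_density \<phi> n v z = 1 / pi * (A + q * (cmod Y)\<^sup>2) * exp (- q)"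
    unfolding root_density_def Let_def
    by (simp only: K_def[symmetric] K11_def[symmetric] L_cnj complex_mod_cnj q)
qed

section \<open>Perturbation of the limit formula\<close>

text \<open>The bound is relative to \<open>1 + |X|\<^sup>2\<close>, because \<open>X\<close> will not be bounded: the cross term
  \<open>2 |c| |X|\<close> is absorbed by \<open>2 |X| \<le> 1 + |X|\<^sup>2\<close>.\<close>

lemma cmod_square_perturbation:
  fixes X c :: complex
  assumes "cmod c \<le> h" "h \<le> 1"
  shows "\<bar>(cmod (X - c))\<^sup>2 - (cmod X)\<^sup>2\<bar> \<le> h * (2 + (cmod X)\<^sup>2)"
proof -
  have "h \<ge> 0"
    using assms norm_ge_zero[of c] by linarith
  have "\<bar>cmod (X - c) - cmod X\<bar> \<le> cmod c"
    using norm_triangle_ineq3[of "X - c" X] by simp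
  moreover have "cmod (X - c) + cmod X \<le> 2 * cmod X + cmod c"
    using norm_triangle_ineq4[of X c] by simp
  moreover have "(cmod (X - c))\<^sup>2 - (cmod X)\<^sup>2 = (cmod (X - c) - cmod X) * (cmod (X - c) + cmod X)"
    by (simp add: power2_eq_square algebra_simps)
  ultimately have "\<bar>(cmod (X - c))\<^sup>2 - (cmod X)\<^sup>2\<bar> \<le> cmod c * (2 * cmod X + cmod c)"
    by (simp add: abs_mult mult_mono)
  also have "\<dots> \<le> h * (2 * cmod X + 1)"
    using assms \<open>h \<ge> 0\<close> by (intro mult_mono) auto
  also have "\<dots> \<le> h * (2 + (cmod X)\<^sup>2)"
    using \<open>h \<ge> 0\<close> sum_squares_bound[of "cmod X" 1] by (intro mult_left_mono) auto
  finally show ?thesis .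
qed

lemma abs_ln_le_of_relative_error:
  fixes N D r :: real
  assumes "D > 0" "\<bar>N - D\<bar> \<le> r * D" "r \<le> 1 / 2"
  shows "\<bar>ln (N / D)\<bar> \<le> 2 * r"
proof -
  define x where "x = N / D - 1"
  have "\<bar>x\<bar> = \<bar>N - D\<bar> / D"
    using \<open>D > 0\<close> by (simp add: x_def field_simps)
  also have "\<dots> \<le> r"
    using assms by (simp add: pos_divide_le_eq)
  finally have x: "\<bar>x\<bar> \<le> r" .
  then have "\<bar>ln (1 + x) - x\<bar> \<le> 2 * x\<^sup>2"
    using assms by (intro abs_ln_one_plus_x_minus_x_bound) simp
  also have "\<dots> = (2 * \<bar>x\<bar>) * \<bar>x\<bar>"
    by (simp add: power2_eq_square)
  also have "\<dots> \<le> 1 * \<bar>x\<bar>"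
    using x assms by (intro mult_right_mono) auto
  finally have "\<bar>ln (1 + x)\<bar> \<le> 2 * r"
    using x by linarith
  then show ?thesis
    by (simp add: x_def)
qed

text \<open>Every change made when \<open>b\<close> and \<open>b'\<close> are dropped from \<open>N\<close> is at most a multiple of \<open>h\<close> times
  \<open>1 + V q |X|\<^sup>2\<close>, and this is at most \<open>D\<close> because \<open>a \<ge> 1\<close>. The constants depend on \<open>V\<close> alone, neither on
  \<open>X\<close> nor on \<open>a\<close>, which is what makes the estimate uniform.\<close>

lemma log_bracket_perturbation:
  fixes X b b' :: complex and V q a h :: real
  assumes b: "cmod b \<le> h" and b': "cmod b' \<le> h"
    and h: "h \<le> 1 / 2" "(3 + 3 * V) * h \<le> 1 / 2"
    and V: "V \<ge> 0" and q: "0 \<le> q" "q \<le> 1" and a: "a \<ge> 1"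
  defines "\<beta> \<equiv> 1 - (cmod b)\<^sup>2"
  defines "N \<equiv> a - (cmod b' / \<beta>)\<^sup>2 + V * q / \<beta> * (cmod (X - b * cnj b' / of_real \<beta>))\<^sup>2"
    and "D \<equiv> a + V * q * (cmod X)\<^sup>2"
  shows "\<bar>ln (N / D) + (V * q - V * q / \<beta>)\<bar> \<le> (6 + 7 * V) * h"
proof -
  have h0: "h \<ge> 0"
    using b norm_ge_zero[of b] by linarith
  have hh: "h * h \<le> h / 2"
    using mult_left_mono[OF h(1) h0] by simp
  have bb: "(cmod b)\<^sup>2 \<le> h * h"
    unfolding power2_eq_square using b h0 by (intro mult_mono) auto
  have "h * h \<le> 1 / 4"
    using hh h by linarith
  then have \<beta>: "\<beta> \<ge> 3 / 4" "\<beta> \<le> 1"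
    using bb by (auto simp: \<beta>_def)
  define d where "d = 1 / \<beta> - 1"
  have d0: "d \<ge> 0"
    using \<beta> by (simp add: d_def field_simps)
  have "d = (cmod b)\<^sup>2 / \<beta>"
    using \<beta> by (simp add: d_def \<beta>_def field_simps)
  also have "\<dots> \<le> (h / 2) / (3 / 4)"
    using bb hh \<beta> h0 by (intro frac_le) auto
  finally have d: "d \<le> h"
    using h0 by simp
  have inv: "1 / \<beta> = 1 + d"
    by (simp add: d_def)
  define c where "c = b * cnj b' / of_real \<beta>"
  have "cmod c = cmod b * cmod b' / \<beta>"
    using \<beta> by (simp add: c_def norm_divide norm_mult)
  also have "\<dots> \<le> (h / 2) / (3 / 4)"
    using b b' h0 hh \<beta> by (intro frac_le order_trans[OF mult_mono hh]) auto
  finally have c: "cmod c \<le> h"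
    using h0 by simp
  have "cmod b' / \<beta> \<le> h / (3 / 4)"
    using b' \<beta> h0 by (intro frac_le) auto
  then have "(cmod b' / \<beta>)\<^sup>2 \<le> (h / (3 / 4))\<^sup>2"
    using \<beta> by (intro power_mono) auto
  also have "\<dots> = 16 / 9 * (h * h)"
    by (simp add: power2_eq_square)
  finally have \<delta>: "(cmod b' / \<beta>)\<^sup>2 \<le> h"
    using hh h0 by linarith
  define Y where "Y = (cmod X)\<^sup>2"
  define Z where "Z = (cmod (X - c))\<^sup>2"
  have Y: "Y \<ge> 0"
    by (simp add: Y_def)
  have ZY: "\<bar>Z - Y\<bar> \<le> h * (2 + Y)"
    unfolding Z_def Y_def using cmod_square_perturbation[OF c] h by simp
  have "\<bar>(1 + d) * Z - Y\<bar> = \<bar>(1 + d) * (Z - Y) + d * Y\<bar>"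
    by (simp add: algebra_simps)
  also have "\<dots> \<le> (1 + d) * \<bar>Z - Y\<bar> + d * Y"
    using d0 Y by (simp add: abs_mult order_trans[OF abs_triangle_ineq])
  also have "\<dots> \<le> (3 / 2) * (h * (2 + Y)) + h * Y"
    using d d0 h Y ZY h0 by (intro add_mono mult_mono) auto
  also have "\<dots> \<le> 3 * h * (1 + Y)"
    using h0 Y by (simp add: algebra_simps)
  finally have ZdY: "\<bar>(1 + d) * Z - Y\<bar> \<le> 3 * h * (1 + Y)" .
  have Vq: "0 \<le> V * q" "V * q \<le> V"
    using V q by (simp_all add: mult_left_le)
  have "N - D = V * q * ((1 + d) * Z - Y) - (cmod b' / \<beta>)\<^sup>2"
    unfolding N_def D_def c_def[symmetric] Z_def[symmetric] Y_def[symmetric]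
    using inv by (simp add: algebra_simps divide_inverse)
  then have "\<bar>N - D\<bar> \<le> \<bar>V * q * ((1 + d) * Z - Y)\<bar> + (cmod b' / \<beta>)\<^sup>2"
    by (smt (verit) zero_le_power2)
  also have "\<dots> \<le> V * q * (3 * h * (1 + Y)) + h"
    unfolding abs_mult[of "V * q"] abs_of_nonneg[OF Vq(1)]
    by (intro add_mono mult_left_mono ZdY Vq(1) \<delta>)
  also have "\<dots> = 3 * h * (V * q) + 3 * h * (V * q * Y) + h"
    by (simp add: algebra_simps)
  also have "\<dots> \<le> 3 * h * V + (3 + 3 * V) * h * (V * q * Y) + 3 * h"
    using Vq h0 V Y by (intro add_mono mult_left_mono mult_right_mono) auto
  also have "\<dots> = (3 + 3 * V) * h * (1 + V * q * Y)"
    by (simp add: algebra_simps)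
  also have "\<dots> \<le> (3 + 3 * V) * h * D"
    using a V h0 by (intro mult_left_mono) (auto simp: D_def Y_def)
  finally have "\<bar>N - D\<bar> \<le> (3 + 3 * V) * h * D" .
  moreover have "D > 0"
    using a Vq unfolding D_def by (smt (verit) mult_nonneg_nonneg zero_le_power2)
  ultimately have "\<bar>ln (N / D)\<bar> \<le> 2 * ((3 + 3 * V) * h)"
    using h by (intro abs_ln_le_of_relative_error)
  moreover have "V * q - V * q / \<beta> = - (V * q * d)"
    using inv by (simp add: algebra_simps divide_inverse)
  moreover have "\<bar>V * q * d\<bar> \<le> V * h"
    using Vq d d0 V by (simp add: abs_mult mult_mono)
  ultimately show ?thesis
    by (simp add: algebra_simps)
qed

section \<open>Locally uniform limits of derivatives\<close>

text \<open>Cauchy's estimate on disks of a fixed radius \<open>r\<close> around the points of \<open>K\<close>. These disks fill a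
  compact set, on which the hypothesis applies.\<close>

lemma deriv_tendsto_locally_uniformly:
  fixes f :: "nat \<Rightarrow> complex \<Rightarrow> complex"
  assumes "open S" and hol: "\<And>n. f n holomorphic_on S" and lim: "locally_uniform_limit S f (\<lambda>_. 0)"
  shows "locally_uniform_limit S (\<lambda>n. deriv (f n)) (\<lambda>_. 0)"
  unfolding locally_uniform_limit_def
proof (intro allI impI)
  fix K :: "complex set" assume K: "compact K" "K \<subseteq> S"
  obtain r where r: "r > 0" "(\<Union>z\<in>K. cball z r) \<subseteq> S"
    using compact_subset_open_imp_cball_epsilon_subset[OF K(1) \<open>open S\<close> K(2)] by blast
  define K' where "K' = (\<Union>z\<in>K. cball z r)"
  have "K' = {x + y |x y. x \<in> K \<and> y \<in> cball 0 r}"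
  proof (intro equalityI subsetI)
    fix x assume "x \<in> K'"
    then obtain z where "z \<in> K" "x \<in> cball z r"
      by (auto simp: K'_def)
    then have "x = z + (x - z) \<and> z \<in> K \<and> x - z \<in> cball 0 r"
      by (simp add: dist_norm norm_minus_commute)
    then show "x \<in> {x + y |x y. x \<in> K \<and> y \<in> cball 0 r}"
      by blast
  next
    fix x assume "x \<in> {x + y |x y. x \<in> K \<and> y \<in> cball 0 r}"
    then obtain z y where "x = z + y" "z \<in> K" "y \<in> cball 0 r"
      by blast
    then have "z \<in> K" "x \<in> cball z r"
      by (simp_all add: dist_norm)
    then show "x \<in> K'"
      by (auto simp: K'_def)
  qed
  then have "compact K'"
    using compact_sums[OF K(1) compact_cball[of 0 r]] by simp
  then have u: "uniform_limit K' f (\<lambda>_. 0) sequentially"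
    using lim r by (simp add: locally_uniform_limit_def K'_def)
  show "uniform_limit K (\<lambda>n. deriv (f n)) (\<lambda>_. 0) sequentially"
  proof (rule uniform_limitI)
    fix e :: real assume "e > 0"
    then have "\<forall>\<^sub>F n in sequentially. \<forall>z\<in>K'. dist (f n z) 0 < r * e / 2"
      using r by (intro uniform_limitD[OF u]) simp
    then show "\<forall>\<^sub>F n in sequentially. \<forall>z\<in>K. dist (deriv (f n) z) 0 < e"
    proof (rule eventually_mono, intro ballI)
      fix n z assume small: "\<forall>z\<in>K'. dist (f n z) 0 < r * e / 2" and "z \<in> K"
      then have sub: "cball z r \<subseteq> K'" "cball z r \<subseteq> S"
        using r by (auto simp: K'_def)
      have "norm ((deriv ^^ 1) (f n) z) \<le> fact 1 * (r * e / 2) / r ^ 1"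
      proof (rule Cauchy_inequality)
        show "f n holomorphic_on ball z r" "continuous_on (cball z r) (f n)"
          using sub hol[of n] ball_subset_cball
          by (blast intro: holomorphic_on_subset holomorphic_on_imp_continuous_on)+
        show "norm (f n x) \<le> r * e / 2" if "norm (z - x) = r" for x
          using small sub that by (force simp: dist_norm)
      qed (use r in simp)
      then show "dist (deriv (f n) z) 0 < e"
        using r \<open>e > 0\<close> by (simp add: field_simps)
    qed
  qed
qed

section \<open>Asymptotics of the density\<close>

lemma schur_quotient_holomorphic:
  assumes op: "opuc \<mu> \<phi>"
  shows "schur_quotient (\<phi> (n + 1)) holomorphic_on ball 0 1"
proof -
  have "poly (reversed_poly (\<phi> (n + 1))) z \<noteq> 0" if "z \<in> ball 0 1" for z
    using reversed_dominates(1)[OF op, of z n] that by auto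
  then show ?thesis
    unfolding holomorphic_on_def field_differentiable_def
    using schur_quotient_has_derivative has_field_derivative_at_within by blast
qed

theorem theorem5p1:
  fixes \<mu> :: "complex measure" and \<phi> :: "nat \<Rightarrow> complex poly" and v :: complex
  assumes "opuc \<mu> \<phi>"
    and "nevai_class \<phi>"
  shows "\<exists>(\<epsilon>1 :: nat \<Rightarrow> complex \<Rightarrow> real) (\<epsilon>2 :: nat \<Rightarrow> complex \<Rightarrow> complex) (\<epsilon>3 :: nat \<Rightarrow> complex \<Rightarrow> real).
     locally_uniform_limit (ball 0 1) \<epsilon>1 (\<lambda>_. 0) \<and>
     locally_uniform_limit (ball 0 1) \<epsilon>2 (\<lambda>_. 0) \<and>
     locally_uniform_limit (ball 0 1) \<epsilon>3 (\<lambda>_. 0) \<and>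
     (\<forall>\<^sub>F n in sequentially. \<forall>z \<in> ball 0 1.
        root_density \<phi> n v z =
          (let s = poly (reversed_poly (\<phi> (n + 1))) z;
               s' = poly (pderiv (reversed_poly (\<phi> (n + 1)))) z
           in 1 / pi *
              (1 / (1 - (cmod z)\<^sup>2)\<^sup>2 +
               (cmod v)\<^sup>2 * (1 - (cmod z)\<^sup>2 + \<epsilon>1 n z) / (cmod s)\<^sup>2 *
                 (cmod (z / of_real (1 - (cmod z)\<^sup>2) + (cnj s' + \<epsilon>2 n z) / cnj s))\<^sup>2) *
              exp (- ((cmod v)\<^sup>2 * (1 - (cmod z)\<^sup>2) / (cmod s)\<^sup>2) + \<epsilon>3 n z)))"
proof -
  define V where "V = (cmod v)\<^sup>2"
  define s where "s n z = poly (reversed_poly (\<phi> (n + 1))) z" for n z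
  define s' where "s' n z = poly (pderiv (reversed_poly (\<phi> (n + 1)))) z" for n z
  define b where "b n = schur_quotient (\<phi> (n + 1))" for n
  define X where "X n z = z / of_real (1 - (cmod z)\<^sup>2) + cnj (s' n z) / cnj (s n z)" for n z
  define q where "q n z = (1 - (cmod z)\<^sup>2) / (cmod (s n z))\<^sup>2" for n z
  define D where "D n z = 1 / (1 - (cmod z)\<^sup>2)\<^sup>2 + V * q n z * (cmod (X n z))\<^sup>2" for n z
  \<comment> \<open>Once the first two errors are zero, the identity forces the third to be this logarithm.\<close>
  define \<epsilon> where "\<epsilon> n z = ln (root_density \<phi> n v z / (1 / pi * D n z)) + V * q n z" for n z
  have V: "V \<ge> 0"
    by (simp add: V_def)
  have t: "0 < 1 - (cmod z)\<^sup>2" "1 - (cmod z)\<^sup>2 \<le> 1" if "z \<in> ball 0 1" for z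
    using that by (auto simp: abs_square_less_1)
  have q: "0 \<le> q n z" "q n z \<le> 1" if "z \<in> ball 0 1" for n z
    using reversed_dominates(2)[OF assms(1), of z n] t[OF that] that
    by (auto simp: q_def s_def divide_le_eq)
  have a: "1 \<le> 1 / (1 - (cmod z)\<^sup>2)\<^sup>2" if "z \<in> ball 0 1" for z
    using t[OF that] by (simp add: power_le_one)
  have D: "D n z > 0" if "z \<in> ball 0 1" for n z
    unfolding D_def using a[OF that] q[OF that] V
    by (intro add_pos_nonneg mult_nonneg_nonneg) auto
  define \<beta> where "\<beta> n z = 1 - (cmod (b n z))\<^sup>2" for n z
  define N where "N n z = 1 / (1 - (cmod z)\<^sup>2)\<^sup>2 - (cmod (deriv (b n) z) / \<beta> n z)\<^sup>2
    + V * q n z / \<beta> n z * (cmod (X n z - b n z * cnj (deriv (b n) z) / of_real (\<beta> n z)))\<^sup>2" for n z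
  have \<beta>: "\<beta> n z > 0" if "z \<in> ball 0 1" for n z
  proof -
    have "cmod (b n z) < 1"
      using reversed_dominates(1)[OF assms(1), of z n] that
      by (simp add: b_def schur_quotient_def norm_divide divide_less_eq)
    then show ?thesis
      by (simp add: \<beta>_def abs_square_less_1)
  qed
  have density: "root_density \<phi> n v z = 1 / pi * N n z * exp (- (V * q n z / \<beta> n z))"
    and N: "N n z > 0" if "z \<in> ball 0 1" "n \<ge> 1" for n z
  proof -
    have z: "cmod z < 1"
      using that by simp
    note rd = root_density_schur[OF assms(1) z that(2)]
    show "root_density \<phi> n v z = 1 / pi * N n z * exp (- (V * q n z / \<beta> n z))"
      using rd(1) by (simp add: N_def V_def q_def \<beta>_def b_def X_def s_def s'_def)
    show "N n z > 0"
      unfolding N_def using rd(2) V q[OF that(1), of n] \<beta>[OF that(1), of n]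
      by (intro add_pos_nonneg mult_nonneg_nonneg divide_nonneg_pos) (auto simp: \<beta>_def b_def)
  qed
  have \<epsilon>_eq: "\<epsilon> n z = ln (N n z / D n z) + (V * q n z - V * q n z / \<beta> n z)"
    if "z \<in> ball 0 1" "n \<ge> 1" for n z
  proof -
    have "root_density \<phi> n v z / (1 / pi * D n z) = (N n z / D n z) * exp (- (V * q n z / \<beta> n z))"
      unfolding density[OF that] by simp
    moreover have "ln ((N n z / D n z) * exp (- (V * q n z / \<beta> n z)))
        = ln (N n z / D n z) - V * q n z / \<beta> n z"
      using N[OF that] D[OF that(1), of n] by (subst ln_mult) simp_all
    ultimately show ?thesis
      by (simp only: \<epsilon>_def)
  qed
  have exact: "root_density \<phi> n v z = 1 / pi * D n z * exp (- (V * q n z) + \<epsilon> n z)"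
    if "z \<in> ball 0 1" "n \<ge> 1" for n z
  proof -
    have "root_density \<phi> n v z > 0"
      unfolding density[OF that] using N[OF that] by simp
    then have "exp (- (V * q n z) + \<epsilon> n z) = root_density \<phi> n v z / (1 / pi * D n z)"
      using D[OF that(1), of n] by (simp add: \<epsilon>_def)
    then show ?thesis
      using D[OF that(1), of n] by simp
  qed
  have b_lim: "locally_uniform_limit (ball 0 1) b (\<lambda>_. 0)"
    unfolding locally_uniform_limit_def
  proof (intro allI impI)
    fix K :: "complex set" assume "compact K" "K \<subseteq> ball 0 1"
    then have "uniform_limit K (\<lambda>n. schur_quotient (\<phi> n)) (\<lambda>_. 0) sequentially"
      using assms(2) unfolding nevai_class_def locally_uniform_limit_def
      by (simp add: schur_quotient_def [abs_def])
    from filterlim_compose[OF this filterlim_add_const_nat_at_top[of 1]]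
    show "uniform_limit K b (\<lambda>_. 0) sequentially"
      by (simp add: b_def [abs_def])
  qed
  have b'_lim: "locally_uniform_limit (ball 0 1) (\<lambda>n. deriv (b n)) (\<lambda>_. 0)"
    unfolding b_def
    by (intro deriv_tendsto_locally_uniformly schur_quotient_holomorphic[OF assms(1)])
      (use b_lim in \<open>simp_all add: b_def [abs_def]\<close>)
  have \<epsilon>_lim: "locally_uniform_limit (ball 0 1) \<epsilon> (\<lambda>_. 0)"
    unfolding locally_uniform_limit_def
  proof (intro allI impI uniform_limitI)
    fix K :: "complex set" and e :: real
    assume K: "compact K" "K \<subseteq> ball 0 1" and "e > 0"
    define h where "h = min (1 / 2) (min (1 / 2 / (3 + 3 * V)) (e / 2 / (6 + 7 * V)))"
    have "h > 0"
      using V \<open>e > 0\<close> by (simp add: h_def)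
    have h: "h \<le> 1 / 2" "(3 + 3 * V) * h \<le> 1 / 2" "(6 + 7 * V) * h < e"
    proof -
      have "h \<le> 1 / 2 / (3 + 3 * V)" "h \<le> e / 2 / (6 + 7 * V)"
        by (simp_all add: h_def)
      then have "h * (3 + 3 * V) \<le> 1 / 2" "h * (6 + 7 * V) \<le> e / 2"
        using V by (simp_all add: pos_le_divide_eq algebra_simps)
      then show "(3 + 3 * V) * h \<le> 1 / 2" "(6 + 7 * V) * h < e"
        using \<open>e > 0\<close> by (simp_all add: mult.commute)
    qed (unfold h_def, rule min.cobounded1)
    have "uniform_limit K b (\<lambda>_. 0) sequentially"
      "uniform_limit K (\<lambda>n. deriv (b n)) (\<lambda>_. 0) sequentially"
      using b_lim b'_lim K by (simp_all add: locally_uniform_limit_def)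
    from this[THEN uniform_limitD, OF \<open>h > 0\<close>]
    have "\<forall>\<^sub>F n in sequentially. \<forall>z\<in>K. dist (b n z) 0 < h"
      "\<forall>\<^sub>F n in sequentially. \<forall>z\<in>K. dist (deriv (b n) z) 0 < h"
      by simp_all
    then show "\<forall>\<^sub>F n in sequentially. \<forall>z\<in>K. dist (\<epsilon> n z) 0 < e"
      using eventually_ge_at_top[of 1]
    proof eventually_elim
      case (elim n)
      show ?case
      proof
        fix z assume "z \<in> K"
        then have z: "z \<in> ball 0 1"
          using K by blast
        have "\<bar>\<epsilon> n z\<bar> \<le> (6 + 7 * V) * h"
          unfolding \<epsilon>_eq[OF z elim(3)] N_def D_def \<beta>_def
          using elim(1,2) \<open>z \<in> K\<close> h
          by (intro log_bracket_perturbation V q[OF z] a[OF z]) (auto intro: less_imp_le)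
        then show "dist (\<epsilon> n z) 0 < e"
          using h by (simp add: dist_norm)
      qed
    qed
  qed
  have zero: "locally_uniform_limit (ball 0 1) (\<lambda>n z. 0 :: 'a :: real_normed_vector) (\<lambda>_. 0)"
    by (simp add: locally_uniform_limit_def uniform_limit_const)
  show ?thesis
  proof (intro exI conjI)
    show "\<forall>\<^sub>F n in sequentially. \<forall>z \<in> ball 0 1.
        root_density \<phi> n v z =
          (let s = poly (reversed_poly (\<phi> (n + 1))) z;
               s' = poly (pderiv (reversed_poly (\<phi> (n + 1)))) z
           in 1 / pi *
              (1 / (1 - (cmod z)\<^sup>2)\<^sup>2 +
               (cmod v)\<^sup>2 * (1 - (cmod z)\<^sup>2 + 0) / (cmod s)\<^sup>2 *
                 (cmod (z / of_real (1 - (cmod z)\<^sup>2) + (cnj s' + 0) / cnj s))\<^sup>2) *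
              exp (- ((cmod v)\<^sup>2 * (1 - (cmod z)\<^sup>2) / (cmod s)\<^sup>2) + \<epsilon> n z))"
      using eventually_ge_at_top[of 1]
      by eventually_elim (simp add: exact D_def q_def X_def V_def s_def s'_def Let_def)
  qed (use zero \<epsilon>_lim in simp_all)
qed

end
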